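(* There is no stable base $\mathcal{B}$ where the law $\mathrm{prove}_\rho(\mathrm{prove}_\rho(A))\ \vdash_\rho\ \mathrm{prove}_\rho(A)$ holds (i.e. is true for every algorithmic statement $A$) for all $\mathcal{B}$-libraries $\rho$. In particular, there is no stable base $\mathcal{B}$ where $\mathrm{prove}_\rho(A)\ \vdash_\rho\ A$ holds for all algorithmic statements $A$ and all $\mathcal{B}$-libraries $\rho$. So no stable base contains Rule $P_{13}$, the rule implementing the diagram $\mathrm{prove}_\rho(A)\,/\,A$, or Rule $P_{14}$, the rule implementing the diagram $\mathrm{prove}_\rho(\mathrm{prove}_\rho(A))\,/\,\mathrm{prove}_\rho(A)$.
   Context: Framework. Algorithms are recursive algorithms in a fixed standard model. A datum is anything that can be input to an algorithm; data include natural numbers and algorithms, and every finite list of data is a datum. Every algorithm accepts exactly one input datum and either does not halt or halts with exactly one output datum. Every datum has a positive integer size, only finitely many data have a given size, and the size of a list is strictly greater than the sum of the sizes of its items. A process is a pair (algorithm, input). Every halting process has a positive integer runtime; if a process runs subprocesses in its execution, its runtime is strictly greater than the sum of the runtimes of the halting subprocesses. An algorithmic statement is a datum $[\alpha,u,v]$ with $\alpha$ an algorithm, asserting that $\alpha$ with input $u$ halts with output $v$; it is true if this is so and false otherwise. To say that an algorithmic statement holds is to say that it is true. $\mathcal{T}$ denotes the true statement $[\mathrm{identity},0,0]$, where $\mathrm{identity}$ outputs a copy of its input. Rules and libraries. An algorithmic sequence is an algorithm $\rho$ that halts on every positive integer $n$; its output is written $\rho_n$. A rule is an algorithm which, on every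 input $[H,\rho,m]$ with $H$ a finite list of algorithmic statements (hypothesis list), $\rho$ an algorithmic sequence (nominal library) and $m$ a positive integer (resource integer), halts and outputs a list of algorithmic statements (conclusion list) having $H$ as an initial sublist, and which is monotone: if $m'\ge m$ and every item of $H$ is an item of $H'$, then every item of the output on $[H,\rho,m]$ is an item of the output on $[H',\rho,m']$. A library is an algorithmic sequence $\rho$ such that every $\rho_n$ is a rule (not necessarily distinct); the $\rho_n$ are the rules contained in $\rho$. A rule is $\rho$-valid if for every list $H$ of true statements and every $m$, its output on $[H,\rho,m]$ consists only of true statements. A library $\rho$ is valid if all its rules are $\rho$-valid. Bases. A base is a set $\mathcal{B}$ of rules that is finite or is the set of terms of a library. A $\mathcal{B}$-library is a library containing all rules of $\mathcal{B}$. A $\mathcal{B}$-library $\rho$ is valid outside $\mathcal{B}$ if every rule in $\rho$ which is not in $\mathcal{B}$ is $\rho$-valid. A base $\mathcal{B}$ is stable if every $\mathcal{B}$-library that is valid outside $\mathcal{B}$ is valid. Deduction. Fix a recursive bijection $f:\mathbb{N}_+\to\mathbb{N}_+\times\mathbb{N}_+$. The algorithm $\mathrm{deduce}$, on input $[\Gamma,\rho,B]$ ($\Gamma$ a list of algorithmic statements, $\rho$ a library, $B$ an algorithmic statement), computes lists $H_0=\Gamma,H_1,H_2,\dots$, where for $i>0$ with $f(i)=(k,m)$ the list $H_i$ is the output of $\rho_k$ on $[H_{i-1},\rho,m]$; after computing each $H_i$ it checks whether $B$ is on $H_i$, outputs $1$ if so, and otherwise continues. The algorithmic statement $[\mathrm{deduce},[\Gamma,\rho,B],1]$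 is denoted $\Gamma\vdash_\rho B$ (the notation is used for any datum $\rho$), and $A_1,\dots,A_n\vdash_\rho B$ means this with $\Gamma=[A_1,\dots,A_n]$. $A\Rightarrow_\rho B$ denotes $A\vdash_\rho B$, and $\mathrm{prove}_\rho(A)$ denotes $\mathcal{T}\Rightarrow_\rho A$. Rule diagrams. A rule implementing "$X_1,\dots,X_r\,/\,Y$" is the algorithm which on input $[H,\rho,m]$ outputs $H$ with $Y$ appended for every instance (letters ranging over algorithmic statements) whose premises $X_1,\dots,X_r$ are all on $H$; the $\rho$ in $\mathrm{prove}_\rho$ is the nominal library in the input. *)

theory Defs
  imports Main "HOL-Library.Nat_Bijection" "HOL-Library.Sublist"
begin

section \<open>Partial recursive functions\<close>

text \<open>Kleene's \<open>\<mu>\<close>-recursive functions: \<open>recf_eval f xs y\<close> says that \<open>f\<close> is defined on the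
  arguments \<open>xs\<close> with value \<open>y\<close>.\<close>

datatype recf = Zero | Succ | Proj nat | Cn recf "recf list" | Pr recf recf | Mn recf

inductive recf_eval :: "recf \<Rightarrow> nat list \<Rightarrow> nat \<Rightarrow> bool" where
  Zero: "recf_eval Zero xs 0"
| Succ: "recf_eval Succ [x] (Suc x)"
| Proj: "i < length xs \<Longrightarrow> recf_eval (Proj i) xs (xs ! i)"
| Cn: "list_all2 (\<lambda>g y. recf_eval g xs y) gs ys \<Longrightarrow> recf_eval f ys z
        \<Longrightarrow> recf_eval (Cn f gs) xs z"
| Pr_0: "recf_eval f xs y \<Longrightarrow> recf_eval (Pr f g) (0 # xs) y"
| Pr_Suc: "recf_eval (Pr f g) (n # xs) r \<Longrightarrow> recf_eval g (n # r # xs) y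
        \<Longrightarrow> recf_eval (Pr f g) (Suc n # xs) y"
| Mn: "recf_eval f (n # xs) 0 \<Longrightarrow> (\<forall>i<n. \<exists>y. recf_eval f (i # xs) (Suc y))
        \<Longrightarrow> recf_eval (Mn f) xs n"

definition partial_recursive :: "(nat \<Rightarrow> nat option) \<Rightarrow> bool" where
  "partial_recursive g \<longleftrightarrow> (\<exists>f. \<forall>x y. g x = Some y \<longleftrightarrow> recf_eval f [x] y)"

definition total_recursive :: "(nat \<Rightarrow> nat) \<Rightarrow> bool" where
  "total_recursive g \<longleftrightarrow> partial_recursive (\<lambda>x. Some (g x))"


section \<open>The standard model of algorithms\<close>

text \<open>The type \<open>'d\<close> is the type of all data. \<open>dnat\<close> and \<open>dlist\<close> embed the natural numbers and
  the finite lists of data into the data, \<open>algs\<close> is the set of those data that are algorithms.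
  For \<open>\<alpha> \<in> algs\<close>, \<open>run \<alpha> u\<close> is \<open>Some v\<close> if \<open>\<alpha>\<close> with input \<open>u\<close> halts with output \<open>v\<close>, and \<open>None\<close>
  if it does not halt; \<open>runtime\<close> is meaningful for halting processes only, and \<open>subprocs \<alpha> u\<close>
  lists the subprocesses that the halting process \<open>(\<alpha>, u)\<close> runs. \<open>gcode\<close> is a Goedel numbering of the
  data. \<open>ident\<close>, \<open>sched\<close> and \<open>deduce\<close> are the algorithm identity, the bijection \<open>f\<close> and the algorithm
  deduce.\<close>

record 'd framework =
  dnat :: "nat \<Rightarrow> 'd"
  dlist :: "'d list \<Rightarrow> 'd"
  algs :: "'d set"
  run :: "'d \<Rightarrow> 'd \<Rightarrow> 'd option"
  dsize :: "'d \<Rightarrow> nat"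
  runtime :: "'d \<Rightarrow> 'd \<Rightarrow> nat"
  subprocs :: "'d \<Rightarrow> 'd \<Rightarrow> ('d \<times> 'd) list"
  gcode :: "'d \<Rightarrow> nat"
  ident :: 'd
  sched :: "nat \<Rightarrow> nat \<times> nat"
  deduce :: 'd

definition halts :: "'d framework \<Rightarrow> 'd \<Rightarrow> 'd \<Rightarrow> bool" where
  "halts M \<alpha> u \<longleftrightarrow> run M \<alpha> u \<noteq> None"

definition recursive_map :: "'d framework \<Rightarrow> ('d \<Rightarrow> 'd option) \<Rightarrow> bool" where
  "recursive_map M F \<longleftrightarrow>
     (\<exists>g. partial_recursive g \<and> (\<forall>d. g (gcode M d) = map_option (gcode M) (F d)))"

text \<open>The Goedel numbering is injective, and numbers, lists and algorithms can be recognized,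
  built and taken apart recursively (\<open>list_encode\<close> is the standard coding of lists of numbers).\<close>

locale effective_data =
  fixes M :: "'d framework"
  assumes inj_dnat: "inj (dnat M)"
    and inj_dlist: "inj (dlist M)"
    and inj_gcode: "inj (gcode M)"
    and build_nat: "\<exists>g. total_recursive g \<and> (\<forall>n. gcode M (dnat M n) = g n)"
    and dest_nat: "\<exists>g. total_recursive g \<and> (\<forall>n. g (gcode M (dnat M n)) = Suc n) \<and>
          (\<forall>d. d \<notin> range (dnat M) \<longrightarrow> g (gcode M d) = 0)"
    and build_list: "\<exists>g. total_recursive g \<and>
          (\<forall>ds. gcode M (dlist M ds) = g (list_encode (map (gcode M) ds)))"
    and dest_list: "\<exists>g. total_recursive g \<and>
          (\<forall>ds. g (gcode M (dlist M ds)) = Suc (list_encode (map (gcode M) ds))) \<and>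
          (\<forall>d. d \<notin> range (dlist M) \<longrightarrow> g (gcode M d) = 0)"
    and decide_alg: "\<exists>g. total_recursive g \<and>
          (\<forall>d. g (gcode M d) = (if d \<in> algs M then 1 else 0))"

text \<open>The algorithms are the recursive ones, in an arbitrary standard model: they form an
  acceptable programming system in the sense of Rogers (universal function, completeness and
  the s-m-n property).\<close>

locale recursive_algorithms = effective_data M for M :: "'d framework" +
  assumes universal: "\<exists>g. partial_recursive g \<and> (\<forall>\<alpha>\<in>algs M. \<forall>u.
          g (prod_encode (gcode M \<alpha>, gcode M u)) = map_option (gcode M) (run M \<alpha> u))"
    and complete: "\<And>F. recursive_map M F \<Longrightarrow> \<exists>\<alpha>\<in>algs M. \<forall>u. run M \<alpha> u = F u"
    and smn: "\<exists>g. total_recursive g \<and> (\<forall>\<alpha>\<in>algs M. \<forall>u. \<exists>\<beta>\<in>algs M.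
          gcode M \<beta> = g (prod_encode (gcode M \<alpha>, gcode M u)) \<and>
          (\<forall>x. run M \<beta> x = run M \<alpha> (dlist M [u, x])))"

locale sized_data =
  fixes M :: "'d framework"
  assumes size_pos: "dsize M d > 0"
    and size_finite: "finite {d. dsize M d = n}"
    and size_list: "sum_list (map (dsize M) ds) < dsize M (dlist M ds)"

locale timed_processes =
  fixes M :: "'d framework"
  assumes runtime_pos: "\<alpha> \<in> algs M \<Longrightarrow> halts M \<alpha> u \<Longrightarrow> runtime M \<alpha> u > 0"
    and subprocs_algs: "\<alpha> \<in> algs M \<Longrightarrow> halts M \<alpha> u \<Longrightarrow> (\<beta>, v) \<in> set (subprocs M \<alpha> u) \<Longrightarrow> \<beta> \<in> algs M"
    and runtime_subprocs: "\<alpha> \<in> algs M \<Longrightarrow> halts M \<alpha> u \<Longrightarrow>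
          (\<Sum>(\<beta>, v) \<leftarrow> filter (\<lambda>(\<beta>, v). halts M \<beta> v) (subprocs M \<alpha> u). runtime M \<beta> v)
            < runtime M \<alpha> u"


section \<open>Algorithmic statements, rules and libraries\<close>

definition is_stmt :: "'d framework \<Rightarrow> 'd \<Rightarrow> bool" where
  "is_stmt M A \<longleftrightarrow> (\<exists>\<alpha> u v. \<alpha> \<in> algs M \<and> A = dlist M [\<alpha>, u, v])"

definition holds :: "'d framework \<Rightarrow> 'd \<Rightarrow> bool" where
  "holds M A \<longleftrightarrow> (\<exists>\<alpha> u v. \<alpha> \<in> algs M \<and> A = dlist M [\<alpha>, u, v] \<and> run M \<alpha> u = Some v)"

definition truth :: "'d framework \<Rightarrow> 'd" where
  "truth M = dlist M [ident M, dnat M 0, dnat M 0]"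

definition alg_seq :: "'d framework \<Rightarrow> 'd \<Rightarrow> bool" where
  "alg_seq M \<rho> \<longleftrightarrow> \<rho> \<in> algs M \<and> (\<forall>n\<ge>1. halts M \<rho> (dnat M n))"

definition seq_term :: "'d framework \<Rightarrow> 'd \<Rightarrow> nat \<Rightarrow> 'd" where
  "seq_term M \<rho> n = the (run M \<rho> (dnat M n))"

text \<open>\<open>rule_input H \<rho> m\<close> is the datum \<open>[H, \<rho>, m]\<close>, and \<open>legal_input H \<rho> m\<close> says that it is an input
  of the kind for which rules are specified. \<open>concl r H \<rho> m\<close> is the conclusion list, provided
  that \<open>r\<close> halts with a list as output.\<close>

definition rule_input :: "'d framework \<Rightarrow> 'd list \<Rightarrow> 'd \<Rightarrow> nat \<Rightarrow> 'd" where
  "rule_input M H \<rho> m = dlist M [dlist M H, \<rho>, dnat M m]"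

definition legal_input :: "'d framework \<Rightarrow> 'd list \<Rightarrow> 'd \<Rightarrow> nat \<Rightarrow> bool" where
  "legal_input M H \<rho> m \<longleftrightarrow> (\<forall>A\<in>set H. is_stmt M A) \<and> alg_seq M \<rho> \<and> m \<ge> 1"

definition concl :: "'d framework \<Rightarrow> 'd \<Rightarrow> 'd list \<Rightarrow> 'd \<Rightarrow> nat \<Rightarrow> 'd list" where
  "concl M r H \<rho> m = (THE K. run M r (rule_input M H \<rho> m) = Some (dlist M K))"

definition is_rule :: "'d framework \<Rightarrow> 'd \<Rightarrow> bool" where
  "is_rule M r \<longleftrightarrow> r \<in> algs M \<and>
     (\<forall>H \<rho> m. legal_input M H \<rho> m \<longrightarrow>
        (\<exists>K. run M r (rule_input M H \<rho> m) = Some (dlist M K) \<and>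
             (\<forall>A\<in>set K. is_stmt M A) \<and> prefix H K)) \<and>
     (\<forall>H H' \<rho> m m'. legal_input M H \<rho> m \<and> legal_input M H' \<rho> m' \<and> m \<le> m' \<and> set H \<subseteq> set H' \<longrightarrow>
        set (concl M r H \<rho> m) \<subseteq> set (concl M r H' \<rho> m'))"

definition library :: "'d framework \<Rightarrow> 'd \<Rightarrow> bool" where
  "library M \<rho> \<longleftrightarrow> alg_seq M \<rho> \<and> (\<forall>n\<ge>1. is_rule M (seq_term M \<rho> n))"

definition rules_of :: "'d framework \<Rightarrow> 'd \<Rightarrow> 'd set" where
  "rules_of M \<rho> = seq_term M \<rho> ` {1..}"

definition rule_valid :: "'d framework \<Rightarrow> 'd \<Rightarrow> 'd \<Rightarrow> bool" where
  "rule_valid M \<rho> r \<longleftrightarrow>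
     (\<forall>H m. (\<forall>A\<in>set H. holds M A) \<and> m \<ge> 1 \<longrightarrow> (\<forall>A\<in>set (concl M r H \<rho> m). holds M A))"

definition valid_library :: "'d framework \<Rightarrow> 'd \<Rightarrow> bool" where
  "valid_library M \<rho> \<longleftrightarrow> library M \<rho> \<and> (\<forall>r\<in>rules_of M \<rho>. rule_valid M \<rho> r)"


section \<open>Bases\<close>

definition is_base :: "'d framework \<Rightarrow> 'd set \<Rightarrow> bool" where
  "is_base M B \<longleftrightarrow> (\<forall>r\<in>B. is_rule M r) \<and> (finite B \<or> (\<exists>\<rho>. library M \<rho> \<and> B = rules_of M \<rho>))"

definition base_library :: "'d framework \<Rightarrow> 'd set \<Rightarrow> 'd \<Rightarrow> bool" where
  "base_library M B \<rho> \<longleftrightarrow> library M \<rho> \<and> B \<subseteq> rules_of M \<rho>"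

definition valid_outside :: "'d framework \<Rightarrow> 'd set \<Rightarrow> 'd \<Rightarrow> bool" where
  "valid_outside M B \<rho> \<longleftrightarrow> (\<forall>r \<in> rules_of M \<rho> - B. rule_valid M \<rho> r)"

definition stable_base :: "'d framework \<Rightarrow> 'd set \<Rightarrow> bool" where
  "stable_base M B \<longleftrightarrow> is_base M B \<and>
     (\<forall>\<rho>. base_library M B \<rho> \<and> valid_outside M B \<rho> \<longrightarrow> valid_library M \<rho>)"


section \<open>Deduction\<close>

fun deduce_list :: "'d framework \<Rightarrow> 'd list \<Rightarrow> 'd \<Rightarrow> nat \<Rightarrow> 'd list" where
  "deduce_list M \<Gamma> \<rho> 0 = \<Gamma>"
| "deduce_list M \<Gamma> \<rho> (Suc i) =
     (let (k, m) = sched M (Suc i) in concl M (seq_term M \<rho> k) (deduce_list M \<Gamma> \<rho> i) \<rho> m)"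

definition turnstile :: "'d framework \<Rightarrow> 'd list \<Rightarrow> 'd \<Rightarrow> 'd \<Rightarrow> 'd" where
  "turnstile M \<Gamma> \<rho> B = dlist M [deduce M, dlist M [dlist M \<Gamma>, \<rho>, B], dnat M 1]"

definition implies :: "'d framework \<Rightarrow> 'd \<Rightarrow> 'd \<Rightarrow> 'd \<Rightarrow> 'd" where
  "implies M \<rho> A B = turnstile M [A] \<rho> B"

definition prove :: "'d framework \<Rightarrow> 'd \<Rightarrow> 'd \<Rightarrow> 'd" where
  "prove M \<rho> A = implies M \<rho> (truth M) A"

text \<open>Only the input-output behaviour of deduce on its intended inputs is prescribed. Letting \<open>i\<close>
  start at \<open>0\<close> is harmless, since \<open>\<Gamma>\<close> is an initial sublist of every later list.\<close>

locale algorithmic_framework =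
  recursive_algorithms M + sized_data M + timed_processes M for M :: "'d framework" +
  assumes ident_alg: "ident M \<in> algs M"
    and run_ident: "run M (ident M) u = Some u"
    and sched_bij: "bij_betw (sched M) {1..} ({1..} \<times> {1..})"
    and sched_rec: "\<exists>g. total_recursive g \<and> (\<forall>i\<ge>1. g i = prod_encode (sched M i))"
    and deduce_alg: "deduce M \<in> algs M"
    and run_deduce: "(\<forall>A\<in>set \<Gamma>. is_stmt M A) \<Longrightarrow> library M \<rho> \<Longrightarrow> is_stmt M B \<Longrightarrow>
          run M (deduce M) (dlist M [dlist M \<Gamma>, \<rho>, B]) =
            (if \<exists>i. B \<in> set (deduce_list M \<Gamma> \<rho> i) then Some (dnat M 1) else None)"


section \<open>Rule diagrams\<close>

text \<open>A diagram is given by its instances, pairs of a list of premises and a conclusion, which may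
  depend on the nominal library. The order and multiplicity in which the conclusions are appended
  are left open, so all possible implementations are covered.\<close>

definition implements :: "'d framework \<Rightarrow> 'd \<Rightarrow> ('d \<Rightarrow> ('d list \<times> 'd) set) \<Rightarrow> bool" where
  "implements M r D \<longleftrightarrow> is_rule M r \<and>
     (\<forall>H \<rho> m. legal_input M H \<rho> m \<longrightarrow>
        (\<exists>Ys. run M r (rule_input M H \<rho> m) = Some (dlist M (H @ Ys)) \<and>
              set Ys = {Y. \<exists>Xs. (Xs, Y) \<in> D \<rho> \<and> set Xs \<subseteq> set H}))"

definition diagram_P13 :: "'d framework \<Rightarrow> 'd \<Rightarrow> ('d list \<times> 'd) set" where
  "diagram_P13 M \<rho> = {([prove M \<rho> A], A) | A. is_stmt M A}"

definition diagram_P14 :: "'d framework \<Rightarrow> 'd \<Rightarrow> ('d list \<times> 'd) set" where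
  "diagram_P14 M \<rho> = {([prove M \<rho> (prove M \<rho> A)], prove M \<rho> A) | A. is_stmt M A}"

end

theory Submission
  imports Defs
begin

text \<open>Let \<open>F\<close> be a false statement and let \<open>r\<close> be the rule that, whatever the hypotheses, appends
  \<open>prove\<^sub>\<rho> (prove\<^sub>\<rho> F)\<close>, with \<open>\<rho>\<close> the nominal library. Take a library \<open>\<rho>\<close> whose rules are those of the
  stable base and \<open>r\<close>. One use of \<open>r\<close> followed by the law deduces \<open>prove\<^sub>\<rho> F\<close> in \<open>\<rho>\<close> from the true
  statement \<open>[identity, 0, 0]\<close>; hence \<open>prove\<^sub>\<rho> (prove\<^sub>\<rho> F)\<close> is true, which makes \<open>r\<close> itself
  \<open>\<rho>\<close>-valid. By stability \<open>\<rho>\<close> is valid, so \<open>prove\<^sub>\<rho> F\<close> and then \<open>F\<close> are true. No recursion theorem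
  is needed: the self-reference is supplied by the nominal library.\<close>

section \<open>Closure properties of the total recursive functions\<close>

text \<open>The equivalence carries existence and uniqueness of the value together through every
  closure step.\<close>

definition recursive_on :: "nat \<Rightarrow> (nat list \<Rightarrow> nat) \<Rightarrow> bool" where
  "recursive_on k F \<longleftrightarrow> (\<exists>f. \<forall>xs. length xs = k \<longrightarrow> (\<forall>y. recf_eval f xs y \<longleftrightarrow> y = F xs))"

inductive_cases ZeroE: "recf_eval Zero xs y"
inductive_cases SuccE: "recf_eval Succ xs y"
inductive_cases ProjE: "recf_eval (Proj i) xs y"
inductive_cases CnE: "recf_eval (Cn f gs) xs y"
inductive_cases Pr_0E: "recf_eval (Pr f g) (0 # xs) y"
inductive_cases Pr_SucE: "recf_eval (Pr f g) (Suc n # xs) y"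

lemma recursive_on_cong:
  assumes "recursive_on k F" "\<And>xs. length xs = k \<Longrightarrow> F xs = G xs"
  shows "recursive_on k G"
proof -
  obtain f where "\<forall>xs. length xs = k \<longrightarrow> (\<forall>y. recf_eval f xs y \<longleftrightarrow> y = F xs)"
    using assms(1) unfolding recursive_on_def by blast
  then show ?thesis unfolding recursive_on_def by (intro exI[of _ f]) (simp add: assms(2))
qed

lemma recursive_on_nth: "i < k \<Longrightarrow> recursive_on k (\<lambda>xs. xs ! i)"
  unfolding recursive_on_def
  by (intro exI[of _ "Proj i"]) (auto elim: ProjE intro: recf_eval.Proj)

lemma recursive_on_zero: "recursive_on k (\<lambda>xs. 0)"
  unfolding recursive_on_def
  by (intro exI[of _ "Zero"]) (auto elim: ZeroE intro: recf_eval.Zero)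

text \<open>The components are single-valued at \<open>xs\<close>, so the list of intermediate
  values has to be \<open>Gs\<close>. The outer \<open>f\<close> may be partial.\<close>

lemma recf_eval_Cn_iff:
  assumes "\<And>i y. i < length gs \<Longrightarrow> recf_eval (gs ! i) xs y \<longleftrightarrow> y = Gs ! i" "length Gs = length gs"
  shows "recf_eval (Cn f gs) xs z \<longleftrightarrow> recf_eval f Gs z"
proof
  assume "recf_eval (Cn f gs) xs z"
  then obtain ys where "list_all2 (\<lambda>g y. recf_eval g xs y) gs ys" "recf_eval f ys z"
    by (auto elim: CnE)
  moreover from this(1) have "ys = Gs"
    using assms by (auto simp: list_all2_conv_all_nth intro: nth_equalityI)
  ultimately show "recf_eval f Gs z" by simp
next
  assume "recf_eval f Gs z"
  moreover have "list_all2 (\<lambda>g y. recf_eval g xs y) gs Gs"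
    using assms by (auto simp: list_all2_conv_all_nth)
  ultimately show "recf_eval (Cn f gs) xs z" by (rule recf_eval.Cn[rotated])
qed

lemma recursive_on_comp:
  assumes F: "recursive_on (length Gs) F" and Gs: "\<forall>G\<in>set Gs. recursive_on k G"
  shows "recursive_on k (\<lambda>xs. F (map (\<lambda>G. G xs) Gs))"
proof -
  obtain f where f: "\<And>xs y. length xs = length Gs \<Longrightarrow> recf_eval f xs y \<longleftrightarrow> y = F xs"
    using F unfolding recursive_on_def by blast
  obtain g where g: "\<And>G xs y. G \<in> set Gs \<Longrightarrow> length xs = k \<Longrightarrow> recf_eval (g G) xs y \<longleftrightarrow> y = G xs"
    using Gs unfolding recursive_on_def by metis
  have "recf_eval (Cn f (map g Gs)) xs y \<longleftrightarrow> y = F (map (\<lambda>G. G xs) Gs)" if "length xs = k" for xs y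
    using that by (subst recf_eval_Cn_iff[where Gs = "map (\<lambda>G. G xs) Gs"]) (auto simp: g f)
  then show ?thesis unfolding recursive_on_def by blast
qed

lemma recursive_on_Suc:
  assumes "recursive_on k F"
  shows "recursive_on k (\<lambda>xs. Suc (F xs))"
proof -
  have "recursive_on (length [F]) (\<lambda>xs. Suc (xs ! 0))"
    unfolding recursive_on_def
    by (intro exI[of _ Succ]) (auto simp: length_Suc_conv elim: SuccE intro: recf_eval.Succ)
  from recursive_on_comp[OF this] assms show ?thesis by simp
qed

lemma recursive_on_const: "recursive_on k (\<lambda>xs. c)"
  by (induction c) (simp_all add: recursive_on_zero recursive_on_Suc)

text \<open>The step function of a primitive recursion receives the counter and the previous value
  before the parameters; this covers steps that look at the parameters alone.\<close>

lemma recursive_on_drop: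
  assumes "recursive_on k F"
  shows "recursive_on (Suc (Suc k)) (\<lambda>xs. F (drop 2 xs))"
proof -
  let ?Gs = "map (\<lambda>i (xs :: nat list). xs ! (i + 2)) [0..<k]"
  have "recursive_on (Suc (Suc k)) (\<lambda>xs. F (map (\<lambda>G. G xs) ?Gs))"
    by (rule recursive_on_comp) (use assms in \<open>auto intro: recursive_on_nth\<close>)
  moreover have "map (\<lambda>G. G xs) ?Gs = drop 2 xs" if "length xs = Suc (Suc k)" for xs
    using that by (auto intro!: nth_equalityI simp: add.commute)
  ultimately show ?thesis by (auto elim!: recursive_on_cong)
qed

lemma recursive_on_rec:
  assumes N: "recursive_on k N" and A: "recursive_on k A"
    and S: "recursive_on (Suc (Suc k)) (\<lambda>ys. S (ys ! 0) (ys ! 1) (drop 2 ys))"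
  shows "recursive_on k (\<lambda>xs. rec_nat (A xs) (\<lambda>n r. S n r xs) (N xs))"
proof -
  obtain a where a: "\<And>xs y. length xs = k \<Longrightarrow> recf_eval a xs y \<longleftrightarrow> y = A xs"
    using A unfolding recursive_on_def by blast
  obtain s where s: "\<And>xs y. length xs = Suc (Suc k) \<Longrightarrow>
      recf_eval s xs y \<longleftrightarrow> y = S (xs ! 0) (xs ! 1) (drop 2 xs)"
    using S unfolding recursive_on_def by blast
  have *: "recf_eval (Pr a s) (n # xs) y \<longleftrightarrow> y = rec_nat (A xs) (\<lambda>n r. S n r xs) n"
    if "length xs = k" for n xs y
  proof (induction n arbitrary: y)
    case 0
    show ?case using that a by (auto elim: Pr_0E intro: recf_eval.Pr_0)
  next
    case (Suc n)
    show ?case using that Suc s by (auto elim!: Pr_SucE intro!: recf_eval.Pr_Suc)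
  qed
  \<comment> \<open>\<open>Pr\<close> recurses on the head of its argument list. Composing with
    \<open>N\<close> at the head and projections behind it makes \<open>N xs\<close> the number of
    rounds.\<close>
  let ?P = "\<lambda>ys. rec_nat (A (tl ys)) (\<lambda>n r. S n r (tl ys)) (hd ys)"
  let ?Gs = "N # map (\<lambda>i (xs :: nat list). xs ! i) [0..<k]"
  have "recursive_on (length ?Gs) ?P"
    unfolding recursive_on_def
    by (intro exI[of _ "Pr a s"]) (auto simp: length_Suc_conv *)
  then have "recursive_on k (\<lambda>xs. ?P (map (\<lambda>G. G xs) ?Gs))"
    by (rule recursive_on_comp) (use N in \<open>auto intro: recursive_on_nth\<close>)
  moreover have "map (\<lambda>G. G xs) (tl ?Gs) = xs" if "length xs = k" for xs
    using that by (auto intro!: nth_equalityI)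
  ultimately show ?thesis by (auto elim!: recursive_on_cong)
qed

lemmas recursive_on_intros =
  recursive_on_nth recursive_on_const recursive_on_Suc

section \<open>Case distinction, arithmetic and the Cantor pairing\<close>

lemma recursive_on_if:
  assumes "recursive_on k N" "recursive_on k A" "recursive_on k B"
  shows "recursive_on k (\<lambda>xs. if N xs = 0 then A xs else B xs)"
proof -
  have "recursive_on k (\<lambda>xs. rec_nat (A xs) (\<lambda>n r. B xs) (N xs))"
    by (intro recursive_on_rec recursive_on_drop assms)
  moreover have "rec_nat a (\<lambda>n r. b) n = (if n = 0 then a else b)" for n and a b :: nat
    by (cases n) auto
  ultimately show ?thesis by simp
qed

lemma recursive_on_add:
  assumes "recursive_on k A" "recursive_on k B"
  shows "recursive_on k (\<lambda>xs. A xs + B xs)"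
proof -
  have "recursive_on k (\<lambda>xs. rec_nat (B xs) (\<lambda>n r. Suc r) (A xs))"
    by (intro recursive_on_rec recursive_on_intros assms) auto
  moreover have "rec_nat b (\<lambda>n. Suc) a = a + b" for a b
    by (induction a) auto
  ultimately show ?thesis by simp
qed

lemma recursive_on_pred:
  assumes "recursive_on k A"
  shows "recursive_on k (\<lambda>xs. A xs - 1)"
proof -
  have "recursive_on k (\<lambda>xs. rec_nat 0 (\<lambda>n r. n) (A xs))"
    by (intro recursive_on_rec recursive_on_intros assms) auto
  moreover have "rec_nat 0 (\<lambda>n r. n) a = a - 1" for a
    by (cases a) auto
  ultimately show ?thesis by simp
qed

lemma recursive_on_diff:
  assumes "recursive_on k A" "recursive_on k B"
  shows "recursive_on k (\<lambda>xs. A xs - B xs)"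
proof -
  have "recursive_on k (\<lambda>xs. rec_nat (A xs) (\<lambda>n r. r - 1) (B xs))"
    by (intro recursive_on_rec recursive_on_pred recursive_on_intros assms) auto
  moreover have "rec_nat a (\<lambda>n r. r - 1) b = a - b" for a b :: nat
    by (induction b) auto
  ultimately show ?thesis by simp
qed

lemma recursive_on_triangle:
  assumes "recursive_on k A"
  shows "recursive_on k (\<lambda>xs. triangle (A xs))"
proof -
  have "recursive_on k (\<lambda>xs. rec_nat 0 (\<lambda>n r. r + Suc n) (A xs))"
    by (intro recursive_on_rec recursive_on_add recursive_on_intros assms) auto
  moreover have "rec_nat 0 (\<lambda>n r. r + Suc n) a = triangle a" for a
    by (induction a) auto
  ultimately show ?thesis by simp
qed

lemma recursive_on_prod_encode:
  assumes "recursive_on k A" "recursive_on k B"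
  shows "recursive_on k (\<lambda>xs. prod_encode (A xs, B xs))"
  unfolding prod_encode_def split
  by (intro recursive_on_add recursive_on_triangle assms)

text \<open>The index of the Cantor diagonal through \<open>z\<close> grows by one exactly when \<open>Suc z\<close> is the next
  triangular number; with truncated subtraction no case distinction is needed.\<close>

lemma diagonal_index:
  "rec_nat 0 (\<lambda>n r. r + (1 - (triangle (Suc r) - Suc n))) z
     = fst (prod_decode z) + snd (prod_decode z)"
proof (induction z)
  case 0
  have "prod_decode 0 = (0, 0)" by (simp add: prod_decode_def prod_decode_aux.simps)
  then show ?case by simp
next
  case (Suc z)
  obtain a b where ab: "prod_decode z = (a, b)" by fastforce
  then have "z = prod_encode (a, b)" by (metis prod_decode_inverse)
  then have z: "z = triangle (a + b) + a" by (simp add: prod_encode_def)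
  have "Suc z = prod_encode (if b = 0 then (0, Suc a) else (Suc a, b - 1))"
    by (cases b) (simp_all add: prod_encode_def z)
  then have "prod_decode (Suc z) = (if b = 0 then (0, Suc a) else (Suc a, b - 1))"
    by (metis prod_encode_inverse)
  with Suc ab z show ?case by auto
qed

text \<open>With \<open>s\<close> the index of the diagonal through \<open>z\<close>, the first
  component is \<open>z - triangle s\<close> and the second is \<open>s\<close> minus the first;
  \<open>diagonal_index\<close> computes \<open>s\<close> by recursion.\<close>

lemma recursive_on_prod_decode:
  assumes "recursive_on k A"
  shows "recursive_on k (\<lambda>xs. fst (prod_decode (A xs)))"
    and "recursive_on k (\<lambda>xs. snd (prod_decode (A xs)))"
proof -
  let ?s = "\<lambda>z. fst (prod_decode z) + snd (prod_decode z)"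
  have s: "recursive_on k (\<lambda>xs. ?s (A xs))"
    unfolding diagonal_index[symmetric]
    by (intro recursive_on_rec recursive_on_add recursive_on_diff recursive_on_triangle
        recursive_on_intros assms) auto
  have z: "z = triangle (?s z) + fst (prod_decode z)" for z
    using prod_decode_inverse[of z] by (simp add: prod_encode_def split_def)
  have "fst (prod_decode z) = z - triangle (?s z)" for z
    using z[of z] by linarith
  then show fst: "recursive_on k (\<lambda>xs. fst (prod_decode (A xs)))"
    using recursive_on_diff[OF assms recursive_on_triangle[OF s]] by presburger
  show "recursive_on k (\<lambda>xs. snd (prod_decode (A xs)))"
    using recursive_on_diff[OF s fst] by simp
qed

section \<open>Operations on codes of lists\<close>

text \<open>\<open>list_encode\<close> sends the empty list to 0 and a nonempty one to
  \<open>Suc\<close> of a pair code, so subtracting 1 exposes head and tail. As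
  \<open>prod_decode 0 = (0, 0)\<close>, the empty list is its own tail.\<close>

definition code_hd :: "nat \<Rightarrow> nat" where
  "code_hd c = fst (prod_decode (c - 1))"

definition code_tl :: "nat \<Rightarrow> nat" where
  "code_tl c = snd (prod_decode (c - 1))"

definition code_drop :: "nat \<Rightarrow> nat \<Rightarrow> nat" where
  "code_drop c = rec_nat c (\<lambda>n. code_tl)"

text \<open>After \<open>n\<close> rounds the accumulator codes the reversed prefix of length
  \<open>n\<close>. The code \<open>c\<close> bounds the length of the list, and surplus rounds
  change nothing.\<close>

definition code_rev :: "nat \<Rightarrow> nat" where
  "code_rev c = rec_nat 0 (\<lambda>n r. if code_drop c n = 0 then r
     else Suc (prod_encode (code_hd (code_drop c n), r))) c"

text \<open>Consing between two reversals; a rule extends its hypothesis list in this way.\<close>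

definition code_snoc :: "nat \<Rightarrow> nat \<Rightarrow> nat" where
  "code_snoc c x = code_rev (Suc (prod_encode (x, code_rev c)))"

lemma code_tl: "code_tl (list_encode xs) = list_encode (tl xs)"
proof (cases xs)
  case Nil
  have "prod_decode 0 = (0, 0)" by (simp add: prod_decode_def prod_decode_aux.simps)
  with Nil show ?thesis by (simp add: code_tl_def)
qed (simp add: code_tl_def)

lemma code_drop: "code_drop (list_encode xs) n = list_encode (drop n xs)"
  by (induction n) (simp_all add: code_drop_def code_tl tl_drop drop_Suc)

lemma length_le_list_encode: "length xs \<le> list_encode xs"
proof (induction xs)
  case (Cons x xs)
  then show ?case using le_prod_encode_2[of "list_encode xs" x] by simp
qed simp

lemma code_rev: "code_rev (list_encode xs) = list_encode (rev xs)"
proof -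
  have "rec_nat 0 (\<lambda>n r. if code_drop (list_encode xs) n = 0 then r
     else Suc (prod_encode (code_hd (code_drop (list_encode xs) n), r))) m
     = list_encode (rev (take m xs))" for m
  proof (induction m)
    case (Suc m)
    show ?case
    proof (cases "m < length xs")
      case True
      then have "drop m xs = xs ! m # drop (Suc m) xs" by (simp add: Cons_nth_drop_Suc)
      with Suc True show ?thesis by (simp add: code_drop code_hd_def take_Suc_conv_app_nth)
    next
      case False
      with Suc show ?thesis by (simp add: code_drop)
    qed
  qed simp
  then show ?thesis unfolding code_rev_def by (simp add: length_le_list_encode)
qed

lemma code_snoc: "code_snoc (list_encode xs) x = list_encode (xs @ [x])"
  unfolding code_snoc_def using code_rev[of "x # rev xs"] by (simp add: code_rev)

lemma recursive_on_code_hd: "recursive_on k A \<Longrightarrow> recursive_on k (\<lambda>xs. code_hd (A xs))"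
  unfolding code_hd_def by (intro recursive_on_prod_decode recursive_on_pred)

lemma recursive_on_code_tl: "recursive_on k A \<Longrightarrow> recursive_on k (\<lambda>xs. code_tl (A xs))"
  unfolding code_tl_def by (intro recursive_on_prod_decode recursive_on_pred)

lemma recursive_on_code_drop:
  "recursive_on k A \<Longrightarrow> recursive_on k N \<Longrightarrow> recursive_on k (\<lambda>xs. code_drop (A xs) (N xs))"
  unfolding code_drop_def
  by (intro recursive_on_rec recursive_on_code_tl recursive_on_intros) auto

lemma recursive_on_code_rev: "recursive_on k A \<Longrightarrow> recursive_on k (\<lambda>xs. code_rev (A xs))"
  unfolding code_rev_def
  by (intro recursive_on_rec recursive_on_if recursive_on_prod_encode recursive_on_code_hd
      recursive_on_code_drop recursive_on_drop recursive_on_intros) auto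

lemma recursive_on_code_snoc:
  "recursive_on k A \<Longrightarrow> recursive_on k B \<Longrightarrow> recursive_on k (\<lambda>xs. code_snoc (A xs) (B xs))"
  unfolding code_snoc_def
  by (intro recursive_on_code_rev recursive_on_prod_encode recursive_on_intros)

section \<open>Composition with recursive functions supplied by the framework\<close>

lemma recursive_on_total:
  assumes "total_recursive g" "recursive_on k A"
  shows "recursive_on k (\<lambda>xs. g (A xs))"
proof -
  obtain f where f: "\<And>x y. g x = y \<longleftrightarrow> recf_eval f [x] y"
    using assms(1) unfolding total_recursive_def partial_recursive_def by auto
  have "recursive_on (length [A]) (\<lambda>xs. g (xs ! 0))"
    unfolding recursive_on_def by (intro exI[of _ f]) (auto simp: length_Suc_conv f[symmetric])
  from recursive_on_comp[OF this] assms(2) show ?thesis by simp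
qed

text \<open>Allows the universal function to be evaluated at the terms of a library, where halting
  is guaranteed.\<close>

lemma recursive_on_partial:
  assumes g: "partial_recursive g" and A: "recursive_on k A"
    and def: "\<And>xs. length xs = k \<Longrightarrow> g (A xs) = Some (F xs)"
  shows "recursive_on k F"
proof -
  obtain f where f: "\<And>x y. g x = Some y \<longleftrightarrow> recf_eval f [x] y"
    using g unfolding partial_recursive_def by blast
  obtain a where a: "\<And>xs y. length xs = k \<Longrightarrow> recf_eval a xs y \<longleftrightarrow> y = A xs"
    using A unfolding recursive_on_def by blast
  have "recf_eval (Cn f [a]) xs y \<longleftrightarrow> y = F xs" if "length xs = k" for xs y
    using that def[OF that] by (subst recf_eval_Cn_iff[where Gs = "[A xs]"]) (auto simp: a f[symmetric])
  then show ?thesis unfolding recursive_on_def by blast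
qed

section \<open>Effective maps on data\<close>

definition items :: "'d framework \<Rightarrow> 'd \<Rightarrow> 'd list" where
  "items M d = (if d \<in> range (dlist M) then inv (dlist M) d else [])"

text \<open>The default value \<open>d\<close> makes \<open>arg M i\<close> total on data, so that no partiality has to be handled
  on inputs that are not of the intended form.\<close>

definition arg :: "'d framework \<Rightarrow> nat \<Rightarrow> 'd \<Rightarrow> 'd" where
  "arg M i d = (if i < length (items M d) then items M d ! i else d)"

definition nat_value :: "'d framework \<Rightarrow> 'd \<Rightarrow> nat" where
  "nat_value M d = (if d \<in> range (dnat M) then inv (dnat M) d else 0)"

definition effective_nat :: "'d framework \<Rightarrow> ('d \<Rightarrow> nat) \<Rightarrow> bool" where
  "effective_nat M F \<longleftrightarrow> (\<exists>g. recursive_on 1 g \<and> (\<forall>d. g [gcode M d] = F d))"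

definition effective :: "'d framework \<Rightarrow> ('d \<Rightarrow> 'd) \<Rightarrow> bool" where
  "effective M F \<longleftrightarrow> effective_nat M (\<lambda>d. gcode M (F d))"

text \<open>On list codes, consing and appending are arithmetical; \<open>build_list\<close> and
  \<open>dest_list\<close> translate to and from the Goedel number of
  \<open>dlist M ds\<close>.\<close>

definition effective_list :: "'d framework \<Rightarrow> ('d \<Rightarrow> 'd list) \<Rightarrow> bool" where
  "effective_list M F \<longleftrightarrow> effective_nat M (\<lambda>d. list_encode (map (gcode M) (F d)))"

lemma effective_id: "effective M (\<lambda>d. d)"
  unfolding effective_def effective_nat_def
  by (intro exI[of _ "\<lambda>xs. xs ! 0"]) (simp add: recursive_on_nth)

lemma effective_const: "effective M (\<lambda>d. c)"
  unfolding effective_def effective_nat_def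
  by (intro exI[of _ "\<lambda>xs. gcode M c"]) (simp add: recursive_on_const)

lemma effective_comp:
  assumes "effective M F" "effective M G"
  shows "effective M (\<lambda>d. F (G d))"
proof -
  obtain f where f: "recursive_on 1 f" "\<And>d. f [gcode M d] = gcode M (F d)"
    using assms(1) unfolding effective_def effective_nat_def by blast
  obtain g where g: "recursive_on 1 g" "\<And>d. g [gcode M d] = gcode M (G d)"
    using assms(2) unfolding effective_def effective_nat_def by blast
  have "recursive_on 1 (\<lambda>xs. f [g xs])"
    using recursive_on_comp[of "[g]" f 1] f g by simp
  then show ?thesis unfolding effective_def effective_nat_def
    by (intro exI[of _ "\<lambda>xs. f [g xs]"]) (simp add: f g)
qed

lemma effective_nat_map1:
  assumes "effective_nat M F" "\<And>g. recursive_on 1 g \<Longrightarrow> recursive_on 1 (\<lambda>xs. h (g xs))"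
  shows "effective_nat M (\<lambda>d. h (F d))"
proof -
  obtain g where "recursive_on 1 g" "\<And>d. g [gcode M d] = F d"
    using assms(1) unfolding effective_nat_def by blast
  then show ?thesis unfolding effective_nat_def
    by (intro exI[of _ "\<lambda>xs. h (g xs)"]) (simp add: assms(2)[unfolded One_nat_def])
qed

lemma effective_nat_map2:
  assumes "effective_nat M F" "effective_nat M G"
    and "\<And>f g. recursive_on 1 f \<Longrightarrow> recursive_on 1 g \<Longrightarrow> recursive_on 1 (\<lambda>xs. h (f xs) (g xs))"
  shows "effective_nat M (\<lambda>d. h (F d) (G d))"
proof -
  obtain f where "recursive_on 1 f" "\<And>d. f [gcode M d] = F d"
    using assms(1) unfolding effective_nat_def by blast
  moreover obtain g where "recursive_on 1 g" "\<And>d. g [gcode M d] = G d"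
    using assms(2) unfolding effective_nat_def by blast
  ultimately show ?thesis unfolding effective_nat_def
    by (intro exI[of _ "\<lambda>xs. h (f xs) (g xs)"]) (simp add: assms(3)[unfolded One_nat_def])
qed

lemma effective_list_Nil: "effective_list M (\<lambda>d. [])"
  unfolding effective_list_def effective_nat_def
  by (intro exI[of _ "\<lambda>xs. 0"]) (simp add: recursive_on_const)

lemma effective_list_Cons:
  "effective M F \<Longrightarrow> effective_list M Fs \<Longrightarrow> effective_list M (\<lambda>d. F d # Fs d)"
  unfolding effective_def effective_list_def list.map list_encode.simps
  by (rule effective_nat_map2) (auto intro: recursive_on_Suc recursive_on_prod_encode)

lemma effective_list_snoc:
  "effective_list M Fs \<Longrightarrow> effective M F \<Longrightarrow> effective_list M (\<lambda>d. Fs d @ [F d])"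
  unfolding effective_def effective_list_def map_append list.map code_snoc[symmetric]
  by (rule effective_nat_map2) (auto intro: recursive_on_code_snoc)

section \<open>Building and taking apart data effectively\<close>

context effective_data
begin

lemma dlist_eq_iff [simp]: "dlist M xs = dlist M ys \<longleftrightarrow> xs = ys"
  using inj_dlist by (auto dest: injD)

lemma dnat_eq_iff [simp]: "dnat M m = dnat M n \<longleftrightarrow> m = n"
  using inj_dnat by (auto dest: injD)

lemma items_dlist [simp]: "items M (dlist M ds) = ds"
  using inj_dlist by (simp add: items_def)

lemma nat_value_dnat [simp]: "nat_value M (dnat M n) = n"
  using inj_dnat by (simp add: nat_value_def)

lemma arg_dlist [simp]: "i < length ds \<Longrightarrow> arg M i (dlist M ds) = ds ! i"
  by (simp add: arg_def)

lemma effective_dlist: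
  assumes "effective_list M Fs"
  shows "effective M (\<lambda>d. dlist M (Fs d))"
proof -
  obtain g where "total_recursive g"
    and "\<And>ds. gcode M (dlist M ds) = g (list_encode (map (gcode M) ds))"
    using build_list by blast
  then show ?thesis
    using assms unfolding effective_list_def effective_def
    by (auto intro: effective_nat_map1 recursive_on_total)
qed

lemma effective_items:
  assumes "effective M F"
  shows "effective_list M (\<lambda>d. items M (F d))"
proof -
  obtain g where g: "total_recursive g"
    and "\<And>ds. g (gcode M (dlist M ds)) = Suc (list_encode (map (gcode M) ds))"
    and "\<And>d. d \<notin> range (dlist M) \<Longrightarrow> g (gcode M d) = 0"
    using dest_list by blast
  \<comment> \<open>Off the lists \<open>g\<close> yields 0, and truncated subtraction keeps it 0,
    the code of the empty list; this matches the default of \<open>items\<close>.\<close>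
  then have items: "list_encode (map (gcode M) (items M d)) = g (gcode M d) - 1" for d
    by (cases "d \<in> range (dlist M)") (auto simp: items_def inj_dlist)
  show ?thesis
    unfolding effective_list_def items
    by (rule effective_nat_map1[OF assms[unfolded effective_def], where h = "\<lambda>c. g c - 1"])
      (intro recursive_on_pred recursive_on_total[OF g])
qed

lemma effective_nat_value: "effective_nat M (nat_value M)"
proof -
  obtain g where g: "total_recursive g" and "\<And>n. g (gcode M (dnat M n)) = Suc n"
    and "\<And>d. d \<notin> range (dnat M) \<Longrightarrow> g (gcode M d) = 0"
    using dest_nat by blast
  then have "nat_value M d = g (gcode M d) - 1" for d
    by (cases "d \<in> range (dnat M)") (auto simp: nat_value_def inj_dnat)
  then show ?thesis unfolding effective_nat_def
    by (intro exI[of _ "\<lambda>xs. g (xs ! 0) - 1"])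
      (simp only: nth_Cons_0 recursive_on_pred recursive_on_total[OF g] recursive_on_nth
        zero_less_one simp_thms)
qed

lemma effective_arg: "effective M (arg M i)"
proof -
  let ?l = "\<lambda>d. list_encode (map (gcode M) (items M d))"
  \<comment> \<open>The list left after dropping \<open>i\<close> items has code 0 exactly if
    \<open>i\<close> is out of range; otherwise its head is item \<open>i\<close>.\<close>
  have arg: "gcode M (arg M i d)
      = (if code_drop (?l d) i = 0 then gcode M d else code_hd (code_drop (?l d) i))" for d
  proof (cases "i < length (items M d)")
    case True
    then have "drop i (items M d) = items M d ! i # drop (Suc i) (items M d)"
      by (simp add: Cons_nth_drop_Suc)
    with True show ?thesis by (simp add: arg_def code_drop drop_map code_hd_def)
  qed (simp add: arg_def code_drop)
  show ?thesis unfolding effective_def arg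
    by (rule effective_nat_map2[OF effective_items[OF effective_id, unfolded effective_list_def]
          effective_id[unfolded effective_def],
          where h = "\<lambda>l c. if code_drop l i = 0 then c else code_hd (code_drop l i)"])
      (intro recursive_on_if recursive_on_code_hd recursive_on_code_drop recursive_on_const)
qed

end

lemmas effective_intros = effective_const effective_list_Nil effective_list_Cons
  effective_list_snoc effective_data.effective_dlist effective_data.effective_items
  effective_data.effective_arg

text \<open>Completeness of the programming system supplies the algorithm; as \<open>F\<close> is
  total, it halts on every datum.\<close>

lemma (in recursive_algorithms) ex_algorithm:
  assumes "effective M F"
  shows "\<exists>\<alpha>\<in>algs M. \<forall>u. run M \<alpha> u = Some (F u)"
proof (rule complete)
  obtain g f where g: "\<And>d. g [gcode M d] = gcode M (F d)"
    and f: "\<And>xs y. length xs = 1 \<Longrightarrow> recf_eval f xs y \<longleftrightarrow> y = g xs"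
    using assms unfolding effective_def effective_nat_def recursive_on_def by blast
  have "partial_recursive (\<lambda>x. Some (g [x]))"
    unfolding partial_recursive_def by (intro exI[of _ f]) (auto simp: f)
  then show "recursive_map M (\<lambda>d. Some (F d))"
    unfolding recursive_map_def using g by (intro exI[of _ "\<lambda>x. Some (g [x])"]) simp
qed

section \<open>Libraries with prescribed rules\<close>

context recursive_algorithms
begin

lemma ex_constant_library:
  assumes "is_rule M r"
  shows "\<exists>\<rho>. library M \<rho> \<and> rules_of M \<rho> = {r}"
proof -
  obtain \<rho> where "\<rho> \<in> algs M" "\<And>u. run M \<rho> u = Some r"
    using ex_algorithm[OF effective_const[of M r]] by blast
  with assms show ?thesis
    by (intro exI[of _ \<rho>])
      (auto simp: library_def alg_seq_def halts_def rules_of_def seq_term_def)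
qed

text \<open>The new library starts with \<open>r\<close> and continues with the terms of
  \<open>\<sigma>\<close>, computed by the universal function.\<close>

lemma ex_shifted_library:
  assumes r: "is_rule M r" and \<sigma>: "library M \<sigma>"
  shows "\<exists>\<rho>. library M \<rho> \<and> rules_of M \<rho> = insert r (rules_of M \<sigma>)"
proof -
  \<comment> \<open>The index into \<open>\<sigma>\<close>. It is 0 at the number 1, where
    \<open>r\<close> is wanted, and at 0 and all data that are not numbers, where \<open>r\<close>
    serves as default.\<close>
  define N where "N d = nat_value M d - 1" for d
  define F where "F d = (if N d = 0 then r else seq_term M \<sigma> (N d))" for d
  obtain e where e: "recursive_on 1 e" "\<And>d. e [gcode M d] = nat_value M d"
    using effective_nat_value unfolding effective_nat_def by blast
  obtain b where b: "total_recursive b" "\<And>n. gcode M (dnat M n) = b n"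
    using build_nat by blast
  obtain U where U: "partial_recursive U"
    "\<And>u. U (prod_encode (gcode M \<sigma>, gcode M u)) = map_option (gcode M) (run M \<sigma> u)"
    using universal \<sigma> unfolding library_def alg_seq_def by blast
  have run_seq: "run M \<sigma> (dnat M n) = Some (seq_term M \<sigma> n)" if "n \<ge> 1" for n
    using \<sigma> that unfolding library_def alg_seq_def halts_def seq_term_def by auto
  \<comment> \<open>Both branches of the case distinction have to be total. The index
    \<open>Suc (e xs - 1 - 1)\<close> is never 0, so \<open>\<sigma>\<close> halts there, and it is
    the wanted index whenever that is positive.\<close>
  define s where "s xs = gcode M (seq_term M \<sigma> (Suc (e xs - 1 - 1)))" for xs
  have s: "recursive_on 1 s"
  proof (rule recursive_on_partial[OF U(1)])
    show "recursive_on 1 (\<lambda>xs. prod_encode (gcode M \<sigma>, b (Suc (e xs - 1 - 1))))"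
      by (intro recursive_on_prod_encode recursive_on_const recursive_on_total[OF b(1)]
          recursive_on_Suc recursive_on_pred e)
    show "U (prod_encode (gcode M \<sigma>, b (Suc (e xs - 1 - 1)))) = Some (s xs)" for xs
      by (simp add: U(2) b(2)[symmetric] run_seq s_def)
  qed
  have "effective M F"
    unfolding effective_def effective_nat_def
  proof (intro exI conjI allI)
    show "recursive_on 1 (\<lambda>xs. if e xs - 1 = 0 then gcode M r else s xs)"
      by (intro recursive_on_if recursive_on_const recursive_on_pred e s)
    have N: "e [gcode M d] - 1 = N d" for d by (simp add: e N_def)
    show "(if e [gcode M d] - 1 = 0 then gcode M r else s [gcode M d]) = gcode M (F d)" for d
      unfolding s_def N F_def by (cases "N d") simp_all
  qed
  from ex_algorithm[OF this] obtain \<rho> where \<rho>: "\<rho> \<in> algs M" "\<And>u. run M \<rho> u = Some (F u)"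
    by blast
  have seq: "seq_term M \<rho> n = (if n - 1 = 0 then r else seq_term M \<sigma> (n - 1))" for n
    by (simp add: seq_term_def \<rho> F_def N_def)
  have "library M \<rho>"
    using r \<sigma> \<rho> by (auto simp: library_def alg_seq_def halts_def seq)
  moreover have "rules_of M \<rho> = insert r (rules_of M \<sigma>)"
  proof
    show "rules_of M \<rho> \<subseteq> insert r (rules_of M \<sigma>)"
      by (auto simp: rules_of_def seq)
    have "r = seq_term M \<rho> 1" by (simp add: seq)
    moreover have "seq_term M \<sigma> n = seq_term M \<rho> (Suc n)" if "n \<ge> 1" for n
      using that by (simp add: seq)
    ultimately show "insert r (rules_of M \<sigma>) \<subseteq> rules_of M \<rho>"
      by (force simp: rules_of_def)
  qed
  ultimately show ?thesis by blast
qed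

text \<open>A finite base is added rule by rule to the constant library of \<open>r\<close>, which
  also covers the empty base. An infinite base is the set of terms of a library, and one shift
  suffices.\<close>

lemma ex_library_insert:
  assumes B: "is_base M B" and r: "is_rule M r"
  shows "\<exists>\<rho>. library M \<rho> \<and> rules_of M \<rho> = insert r B"
proof (cases "finite B")
  case True
  from True B[unfolded is_base_def, THEN conjunct1] show ?thesis
  proof (induction B)
    case empty
    show ?case using ex_constant_library[OF r] by simp
  next
    case (insert q B)
    then obtain \<sigma> where "library M \<sigma>" "rules_of M \<sigma> = insert r B" by auto
    with ex_shifted_library[of q \<sigma>] insert.prems show ?case by (auto simp: insert_commute)
  qed
next
  case False
  with B ex_shifted_library[OF r] show ?thesis unfolding is_base_def by auto
qed

end

section \<open>Deducibility\<close>

context algorithmic_framework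
begin

lemma holds_iff: "holds M (dlist M [\<alpha>, u, v]) \<longleftrightarrow> \<alpha> \<in> algs M \<and> run M \<alpha> u = Some v"
  by (auto simp: holds_def)

lemma holds_is_stmt: "holds M A \<Longrightarrow> is_stmt M A"
  by (auto simp: holds_def is_stmt_def)

lemma is_stmt_turnstile: "is_stmt M (turnstile M \<Gamma> \<rho> A)"
  unfolding is_stmt_def turnstile_def using deduce_alg by blast

lemma is_stmt_prove: "is_stmt M (prove M \<rho> A)"
  by (simp add: prove_def implies_def is_stmt_turnstile)

lemma holds_truth: "holds M (truth M)"
  by (simp add: truth_def holds_iff ident_alg run_ident)

lemma holds_turnstile_iff:
  assumes "\<forall>A\<in>set \<Gamma>. is_stmt M A" "library M \<rho>" "is_stmt M A"
  shows "holds M (turnstile M \<Gamma> \<rho> A) \<longleftrightarrow> (\<exists>i. A \<in> set (deduce_list M \<Gamma> \<rho> i))"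
  by (simp add: turnstile_def holds_iff deduce_alg run_deduce[OF assms])

lemma concl_eq: "run M r (rule_input M H \<rho> m) = Some (dlist M K) \<Longrightarrow> concl M r H \<rho> m = K"
  by (auto simp: concl_def)

lemma is_rule_concl:
  assumes "is_rule M r" "legal_input M H \<rho> m"
  shows "\<forall>A\<in>set (concl M r H \<rho> m). is_stmt M A" "set H \<subseteq> set (concl M r H \<rho> m)"
proof -
  obtain K where "run M r (rule_input M H \<rho> m) = Some (dlist M K)"
    "\<forall>A\<in>set K. is_stmt M A" "prefix H K"
    using assms unfolding is_rule_def by blast
  then show "\<forall>A\<in>set (concl M r H \<rho> m). is_stmt M A" "set H \<subseteq> set (concl M r H \<rho> m)"
    by (simp_all add: concl_eq set_mono_prefix)
qed

lemma is_rule_concl_mono: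
  assumes "is_rule M r" "legal_input M H \<rho> m" "legal_input M H' \<rho> m'" "m \<le> m'" "set H \<subseteq> set H'"
  shows "set (concl M r H \<rho> m) \<subseteq> set (concl M r H' \<rho> m')"
  using assms unfolding is_rule_def by blast

section \<open>The schedule and the growth of deduction lists\<close>

lemma sched_pos:
  assumes "sched M (Suc i) = (k, m)"
  shows "k \<ge> 1" "m \<ge> 1"
proof -
  have "sched M (Suc i) \<in> {1..} \<times> {1..}"
    using sched_bij by (rule bij_betwE[THEN bspec]) simp
  with assms show "k \<ge> 1" "m \<ge> 1" by auto
qed

text \<open>Infinitely many pairs \<open>(k, m')\<close> have \<open>m' \<ge> m\<close>, and only
  finitely many pairs occur up to position \<open>j\<close>; by surjectivity another one comes
  later.\<close>

lemma sched_recurs: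
  assumes "k \<ge> 1" "m \<ge> 1"
  obtains i m' where "i \<ge> j" "m' \<ge> m" "sched M (Suc i) = (k, m')"
proof -
  have "infinite ((\<lambda>m'. (k, m')) ` {m..})"
    by (simp add: finite_image_iff inj_on_def infinite_Ici)
  then have "\<not> (\<lambda>m'. (k, m')) ` {m..} \<subseteq> sched M ` {..j}"
    using finite_subset by blast
  then obtain m' where m': "m' \<ge> m" "(k, m') \<notin> sched M ` {..j}" by auto
  have "(k, m') \<in> sched M ` {1..}"
    using sched_bij assms m' by (auto simp: bij_betw_def)
  then obtain i where "i \<ge> 1" "sched M i = (k, m')" by auto
  moreover from this m' have "i > j"
    by (metis atMost_iff image_eqI not_le)
  ultimately show thesis using that[of "i - 1" m'] m' by simp
qed

lemma legal_deduce_list: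
  assumes "library M \<rho>" "\<forall>A\<in>set \<Gamma>. is_stmt M A" "m \<ge> 1"
  shows "legal_input M (deduce_list M \<Gamma> \<rho> i) \<rho> m"
proof -
  have "\<forall>A\<in>set (deduce_list M \<Gamma> \<rho> i). is_stmt M A"
  proof (induction i)
    case (Suc i)
    obtain k m where km: "sched M (Suc i) = (k, m)" by fastforce
    then have "is_rule M (seq_term M \<rho> k)"
      using assms(1) sched_pos by (auto simp: library_def)
    moreover have "legal_input M (deduce_list M \<Gamma> \<rho> i) \<rho> m"
      using Suc assms(1) sched_pos(2)[OF km] by (simp add: legal_input_def library_def)
    ultimately show ?case using is_rule_concl(1) by (simp add: km)
  qed (use assms in simp)
  then show ?thesis using assms by (simp add: legal_input_def library_def)
qed

lemma deduce_list_mono: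
  assumes "library M \<rho>" "\<forall>A\<in>set \<Gamma>. is_stmt M A" "i \<le> j"
  shows "set (deduce_list M \<Gamma> \<rho> i) \<subseteq> set (deduce_list M \<Gamma> \<rho> j)"
  using _ assms(3)
proof (rule lift_Suc_mono_le)
  fix i
  obtain k m where km: "sched M (Suc i) = (k, m)" by fastforce
  then have "is_rule M (seq_term M \<rho> k)"
    using assms(1) sched_pos by (auto simp: library_def)
  then show "set (deduce_list M \<Gamma> \<rho> i) \<subseteq> set (deduce_list M \<Gamma> \<rho> (Suc i))"
    using is_rule_concl(2) legal_deduce_list[OF assms(1,2) sched_pos(2)[OF km]] by (simp add: km)
qed

text \<open>At some round after \<open>j\<close> the schedule runs \<open>r\<close> with resource at
  least \<open>m\<close>; monotonicity of rules then gives everything that \<open>H\<close>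
  yields.\<close>

lemma deduce_list_apply_rule:
  assumes "library M \<rho>" "\<forall>A\<in>set \<Gamma>. is_stmt M A" "r \<in> rules_of M \<rho>" "m \<ge> 1"
    and H: "legal_input M H \<rho> m" "set H \<subseteq> set (deduce_list M \<Gamma> \<rho> j)"
  shows "\<exists>i. set (concl M r H \<rho> m) \<subseteq> set (deduce_list M \<Gamma> \<rho> i)"
proof -
  obtain k where k: "k \<ge> 1" "r = seq_term M \<rho> k"
    using assms(3) by (auto simp: rules_of_def)
  from sched_recurs[OF k(1) assms(4)] obtain i m'
    where i: "i \<ge> j" "m' \<ge> m" "sched M (Suc i) = (k, m')" .
  have "is_rule M r" using assms(1) k by (simp add: library_def)
  then have "set (concl M r H \<rho> m) \<subseteq> set (concl M r (deduce_list M \<Gamma> \<rho> i) \<rho> m')"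
    using H(1)
  proof (rule is_rule_concl_mono)
    show "legal_input M (deduce_list M \<Gamma> \<rho> i) \<rho> m'"
      using legal_deduce_list assms(1,2) sched_pos(2)[OF i(3)] .
    show "set H \<subseteq> set (deduce_list M \<Gamma> \<rho> i)"
      using H(2) deduce_list_mono[OF assms(1,2) i(1)] by blast
  qed fact
  then show ?thesis using i(3) k(2) by (intro exI[of _ "Suc i"]) simp
qed

text \<open>The deduction from \<open>\<Delta>\<close> is simulated inside the one from
  \<open>\<Gamma>\<close>. A simulated round may take many real ones, since its rule must first be
  scheduled again.\<close>

lemma deduce_list_cut:
  assumes "library M \<rho>" "\<forall>A\<in>set \<Gamma>. is_stmt M A" "\<forall>A\<in>set \<Delta>. is_stmt M A"
    and "set \<Delta> \<subseteq> set (deduce_list M \<Gamma> \<rho> j)"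
  shows "\<exists>i'. set (deduce_list M \<Delta> \<rho> i) \<subseteq> set (deduce_list M \<Gamma> \<rho> i')"
proof (induction i)
  case 0
  show ?case using assms(4) by auto
next
  case (Suc i)
  obtain k m where km: "sched M (Suc i) = (k, m)" by fastforce
  have "seq_term M \<rho> k \<in> rules_of M \<rho>"
    using sched_pos(1)[OF km] by (simp add: rules_of_def)
  with Suc deduce_list_apply_rule[OF assms(1,2) _ sched_pos(2)[OF km]]
    legal_deduce_list[OF assms(1,3) sched_pos(2)[OF km]]
  show ?case by (auto simp: km)
qed

lemma holds_turnstile_cut:
  assumes "library M \<rho>" "is_stmt M A" "is_stmt M B" "is_stmt M C"
    and "holds M (turnstile M [A] \<rho> B)" "holds M (turnstile M [B] \<rho> C)"
  shows "holds M (turnstile M [A] \<rho> C)"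
proof -
  obtain i j where "B \<in> set (deduce_list M [A] \<rho> i)" "C \<in> set (deduce_list M [B] \<rho> j)"
    using assms by (auto simp: holds_turnstile_iff)
  with deduce_list_cut[of \<rho> "[A]" "[B]" i j] assms show ?thesis
    by (auto simp: holds_turnstile_iff)
qed

text \<open>Every round applies a valid rule, so truth passes from each list to the next.\<close>

lemma valid_library_sound:
  assumes "valid_library M \<rho>" "\<forall>A\<in>set \<Gamma>. holds M A" "is_stmt M A"
    and "holds M (turnstile M \<Gamma> \<rho> A)"
  shows "holds M A"
proof -
  have "\<forall>A\<in>set (deduce_list M \<Gamma> \<rho> i). holds M A" for i
  proof (induction i)
    case (Suc i)
    obtain k m where km: "sched M (Suc i) = (k, m)" by fastforce
    then have "rule_valid M \<rho> (seq_term M \<rho> k)"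
      using assms(1) sched_pos(1) by (auto simp: valid_library_def rules_of_def)
    with Suc sched_pos(2)[OF km] show ?case by (simp add: km rule_valid_def)
  qed (use assms in simp)
  moreover obtain i where "A \<in> set (deduce_list M \<Gamma> \<rho> i)"
    using assms by (auto simp: holds_turnstile_iff valid_library_def holds_is_stmt)
  ultimately show ?thesis by blast
qed

lemma holds_turnstile_rule:
  assumes "library M \<rho>" "r \<in> rules_of M \<rho>" "is_stmt M X" "is_stmt M Y"
    and "Y \<in> set (concl M r [X] \<rho> 1)"
  shows "holds M (turnstile M [X] \<rho> Y)"
proof -
  have "legal_input M [X] \<rho> 1"
    using assms by (simp add: legal_input_def library_def)
  with deduce_list_apply_rule[of \<rho> "[X]" r 1 "[X]" 0] assms show ?thesis
    by (auto simp: holds_turnstile_iff)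
qed

lemma holds_turnstile_implements:
  assumes "library M \<rho>" "r \<in> rules_of M \<rho>" "implements M r D" "is_stmt M X" "is_stmt M Y"
    and "([X], Y) \<in> D \<rho>"
  shows "holds M (turnstile M [X] \<rho> Y)"
proof -
  have "legal_input M [X] \<rho> 1"
    using assms by (simp add: legal_input_def library_def)
  then obtain Ys where Ys: "run M r (rule_input M [X] \<rho> 1) = Some (dlist M ([X] @ Ys))"
    "set Ys = {Y. \<exists>Xs. (Xs, Y) \<in> D \<rho> \<and> set Xs \<subseteq> set [X]}"
    using assms(3) unfolding implements_def by blast
  have "Y \<in> set Ys" unfolding Ys(2) using assms(6) by force
  then have "Y \<in> set (concl M r [X] \<rho> 1)" unfolding concl_eq[OF Ys(1)] by simp
  with assms(1,2,4,5) show ?thesis by (rule holds_turnstile_rule)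
qed

section \<open>The paradox\<close>

text \<open>The appended statement depends on the nominal library alone, so monotonicity in
  hypotheses and resource is immediate.\<close>

lemma ex_append_rule:
  assumes "effective M Y" and "\<And>\<rho>. is_stmt M (Y \<rho>)"
  shows "\<exists>r. is_rule M r \<and> (\<forall>H \<rho> m. concl M r H \<rho> m = H @ [Y \<rho>])"
proof -
  \<comment> \<open>Items 0 and 1 of the input are the hypothesis list and the nominal library; the
    defaults of \<open>arg\<close> and \<open>items\<close> make the map total on all other
    data.\<close>
  have "effective M (\<lambda>d. dlist M (items M (arg M 0 d) @ [Y (arg M 1 d)]))"
    by (intro effective_intros effective_comp[OF assms(1)] effective_data_axioms)
  from ex_algorithm[OF this] obtain r where r: "r \<in> algs M"
    "\<And>u. run M r u = Some (dlist M (items M (arg M 0 u) @ [Y (arg M 1 u)]))" by blast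
  have run: "run M r (rule_input M H \<rho> m) = Some (dlist M (H @ [Y \<rho>]))" for H \<rho> m
    by (simp add: r rule_input_def)
  then have concl: "concl M r H \<rho> m = H @ [Y \<rho>]" for H \<rho> m
    by (rule concl_eq)
  have "is_rule M r"
    unfolding is_rule_def concl using r(1) run assms(2) by (auto simp: legal_input_def)
  with concl show ?thesis by blast
qed

lemma no_stable_base_prove_prove:
  assumes stable: "stable_base M B"
    and law: "\<And>\<rho> A. base_library M B \<rho> \<Longrightarrow> is_stmt M A \<Longrightarrow>
      holds M (turnstile M [prove M \<rho> (prove M \<rho> A)] \<rho> (prove M \<rho> A))"
  shows False
proof -
  \<comment> \<open>False because identity returns 0, not 1, on input 0.\<close>
  define F where "F = dlist M [ident M, dnat M 0, dnat M 1]"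
  have F: "is_stmt M F" "\<not> holds M F"
    using ident_alg by (auto simp: F_def is_stmt_def holds_iff run_ident)
  let ?P = "\<lambda>\<rho>. prove M \<rho> F" and ?PP = "\<lambda>\<rho>. prove M \<rho> (prove M \<rho> F)"
  \<comment> \<open>\<open>?PP \<rho>\<close> is built around the datum \<open>\<rho>\<close> by
    forming lists with constants, so writing it down runs no deduction.\<close>
  have "effective M ?PP"
    unfolding prove_def implies_def turnstile_def
    by (intro effective_intros effective_id effective_data_axioms)
  from ex_append_rule[OF this is_stmt_prove] obtain r
    where r: "is_rule M r" "\<And>H \<rho> m. concl M r H \<rho> m = H @ [?PP \<rho>]" by blast
  obtain \<rho> where \<rho>: "library M \<rho>" "rules_of M \<rho> = insert r B"
    using ex_library_insert r(1) stable unfolding stable_base_def by blast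
  then have base: "base_library M B \<rho>" by (auto simp: base_library_def)
  \<comment> \<open>This only says that \<open>?PP \<rho>\<close> is deducible; its truth is still
    open at this point.\<close>
  have "holds M (turnstile M [truth M] \<rho> (?PP \<rho>))"
    by (rule holds_turnstile_rule[of \<rho> r])
      (simp_all add: \<rho> r holds_is_stmt holds_truth is_stmt_prove)
  moreover have "holds M (turnstile M [?PP \<rho>] \<rho> (?P \<rho>))"
    by (rule law[OF base F(1)])
  ultimately have P: "holds M (turnstile M [truth M] \<rho> (?P \<rho>))"
    using holds_turnstile_cut[OF \<rho>(1) holds_is_stmt[OF holds_truth] is_stmt_prove is_stmt_prove]
    by blast
  text \<open>This says that the conclusion which \<open>r\<close> appends is true.\<close>
  then have "rule_valid M \<rho> r"
    by (auto simp: rule_valid_def r prove_def implies_def)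
  \<comment> \<open>Outside \<open>B\<close> the library contains at most \<open>r\<close>, so
    stability applies.\<close>
  then have "valid_library M \<rho>"
    using stable base \<rho>(2) by (auto simp: stable_base_def valid_outside_def)
  then have sound: "holds M A" if "is_stmt M A" "holds M (turnstile M [truth M] \<rho> A)" for A
    using valid_library_sound[of \<rho> "[truth M]" A] that by (simp add: holds_truth)
  \<comment> \<open>Soundness is used twice: for the deduction of \<open>?P \<rho>\<close>, and then
    because \<open>?P \<rho>\<close> itself asserts that \<open>F\<close> is deducible from
    \<open>truth M\<close>.\<close>
  have "holds M (?P \<rho>)"
    using sound P is_stmt_prove by blast
  then have "holds M F"
    using sound F(1) unfolding prove_def implies_def by blast
  with F(2) show False by blast
qed

section \<open>Consequences for reflection and for the two rules\<close>

lemma no_stable_base_prove: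
  assumes "stable_base M B"
    and "\<And>\<rho> A. base_library M B \<rho> \<Longrightarrow> is_stmt M A \<Longrightarrow> holds M (turnstile M [prove M \<rho> A] \<rho> A)"
  shows False
proof (rule no_stable_base_prove_prove[OF assms(1)])
  \<comment> \<open>Reflection for the statement \<open>prove M \<rho> A\<close> is the law already
    excluded.\<close>
  fix \<rho> A assume "base_library M B \<rho>"
  then show "holds M (turnstile M [prove M \<rho> (prove M \<rho> A)] \<rho> (prove M \<rho> A))"
    using is_stmt_prove by (rule assms(2))
qed

text \<open>Every library over the base contains the rule, and one application of it to the single
  premise gives the law.\<close>

lemma no_stable_base_P13:
  assumes "stable_base M B" "r \<in> B" "implements M r (diagram_P13 M)"
  shows False
proof (rule no_stable_base_prove[OF assms(1)])
  fix \<rho> A assume "base_library M B \<rho>" "is_stmt M A"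
  with assms(2,3) show "holds M (turnstile M [prove M \<rho> A] \<rho> A)"
    by (intro holds_turnstile_implements[of \<rho> r "diagram_P13 M"])
      (auto simp: base_library_def diagram_P13_def is_stmt_prove)
qed

lemma no_stable_base_P14:
  assumes "stable_base M B" "r \<in> B" "implements M r (diagram_P14 M)"
  shows False
proof (rule no_stable_base_prove_prove[OF assms(1)])
  fix \<rho> A assume "base_library M B \<rho>" "is_stmt M A"
  with assms(2,3) show "holds M (turnstile M [prove M \<rho> (prove M \<rho> A)] \<rho> (prove M \<rho> A))"
    by (intro holds_turnstile_implements[of \<rho> r "diagram_P14 M"])
      (auto simp: base_library_def diagram_P14_def is_stmt_prove)
qed

end

theorem theorem14p14:
  fixes M :: "'d framework"
  assumes "algorithmic_framework M"
  shows "\<not> (\<exists>B. stable_base M B \<and>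
              (\<forall>\<rho>. base_library M B \<rho> \<longrightarrow>
                (\<forall>A. is_stmt M A \<longrightarrow>
                   holds M (turnstile M [prove M \<rho> (prove M \<rho> A)] \<rho> (prove M \<rho> A)))))
       \<and> \<not> (\<exists>B. stable_base M B \<and>
              (\<forall>\<rho>. base_library M B \<rho> \<longrightarrow>
                (\<forall>A. is_stmt M A \<longrightarrow> holds M (turnstile M [prove M \<rho> A] \<rho> A))))
       \<and> \<not> (\<exists>B r. stable_base M B \<and> r \<in> B \<and> implements M r (diagram_P13 M))
       \<and> \<not> (\<exists>B r. stable_base M B \<and> r \<in> B \<and> implements M r (diagram_P14 M))"
proof -
  interpret algorithmic_framework M by (fact assms)
  show ?thesis
    using no_stable_base_prove_prove no_stable_base_prove no_stable_base_P13 no_stable_base_P14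
    by blast
qed

end
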